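(* Let $o\ge 1$ be an integer (fanout), let $h\ge 1$ be an integer (height), and let $\phi_{\mathrm{DY}}=(V,P,V,P,\ldots)$ be the perfectly alternating vector of length $h$. Let $\mathbf{Q}\subseteq[0,1]^2$ be a set of complementary queries, i.e., $(\varsigma_P,\varsigma_V)\in\mathbf{Q}\Leftrightarrow(\varsigma_V,\varsigma_P)\in\mathbf{Q}$. Then no interleaving performs better in total over all queries in $\mathbf{Q}$ than the dynamic interleaving; that is, for every admissible vector $\phi\in\{P,V\}^h$, $$\sum_{(\varsigma_P,\varsigma_V)\in\mathbf{Q}}\widehat{C}(o,h,\phi_{\mathrm{DY}},\varsigma_P,\varsigma_V)\;\le\;\sum_{(\varsigma_P,\varsigma_V)\in\mathbf{Q}}\widehat{C}(o,h,\phi,\varsigma_P,\varsigma_V).$$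
   Context: Cost model: interleaved keys are organized in a search structure that is a complete tree with fanout $o$ in which every root-to-leaf path has $h$ edges. All nodes on level $i$ partition the data in the same dimension $\phi_i\in\{P,V\}$ ($P$ = path, $V$ = value), so an interleaving is represented by a vector $\phi=(\phi_1,\ldots,\phi_h)\in\{P,V\}^h$. A vector is admissible if it contains equally many $P$s and $V$s (so $h$ is even). A query is a pair $(\varsigma_P,\varsigma_V)\in[0,1]^2$: at each node partitioning in dimension $D$, a search follows a fraction $\varsigma_D$ of the $o$ outgoing branches. The complementary query of $(\varsigma_P,\varsigma_V)$ has path selectivity $\varsigma_V$ and value selectivity $\varsigma_P$. The cost of a search (number of visited nodes) is $$\widehat{C}(o,h,\phi,\varsigma_P,\varsigma_V)=1+\sum_{l=1}^{h}\prod_{i=1}^{l}(o\cdot\varsigma_{\phi_i}).$$ The dynamic interleaving corresponds to the vector $\phi_{\mathrm{DY}}=(V,P,V,P,\ldots)$, alternating and starting with $V$. Sums over $\mathbf{Q}$ are sums of non-negative terms, with values in $[0,\infty]$. *)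

theory Defs
  imports Complex_Main "HOL-Library.Extended_Nonnegative_Real" "HOL-Analysis.Infinite_Sum"
begin

datatype dimension = Path | Value

text \<open>A query is the pair (path selectivity, value selectivity).\<close>

type_synonym query = "real \<times> real"

fun selectivity :: "query \<Rightarrow> dimension \<Rightarrow> real" where
  "selectivity (sP, sV) Path = sP"
| "selectivity (sP, sV) Value = sV"

text \<open>The partitioning dimension of tree level \<open>i\<close> (levels are counted from 1) is the list
  entry \<open>\<phi> ! (i - 1)\<close>; the vectors of interest have length \<open>h\<close>.\<close>

definition search_cost :: "nat \<Rightarrow> nat \<Rightarrow> dimension list \<Rightarrow> query \<Rightarrow> real" where
  "search_cost fanout h \<phi> q =
     1 + (\<Sum>l = 1..h. \<Prod>i = 1..l. real fanout * selectivity q (\<phi> ! (i - 1)))"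

definition admissible :: "nat \<Rightarrow> dimension list \<Rightarrow> bool" where
  "admissible h \<phi> \<longleftrightarrow> length \<phi> = h \<and> count_list \<phi> Path = count_list \<phi> Value"

definition dynamic_interleaving :: "nat \<Rightarrow> dimension list" where
  "dynamic_interleaving h = map (\<lambda>i. if odd i then Value else Path) [1..<Suc h]"

definition complementary_queries :: "query set \<Rightarrow> bool" where
  "complementary_queries Q \<longleftrightarrow>
     Q \<subseteq> {0..1} \<times> {0..1} \<and> (\<forall>sP sV. (sP, sV) \<in> Q \<longleftrightarrow> (sV, sP) \<in> Q)"

text \<open>The query set may be infinite, even uncountable.  Every family in \<^typ>\<open>ennreal\<close> is
  summable, so the unordered infinite sum is the supremum of its finite partial sums; the
  conversion loses nothing, since costs of queries in the unit square are non-negative.\<close>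

definition total_cost :: "nat \<Rightarrow> nat \<Rightarrow> dimension list \<Rightarrow> query set \<Rightarrow> ennreal" where
  "total_cost fanout h \<phi> Q = (\<Sum>\<^sub>\<infinity>q\<in>Q. ennreal (search_cost fanout h \<phi> q))"

end

theory Submission
  imports Defs
begin

text \<open>On level \<open>l\<close> the cost contributes a monomial \<open>x ^ a * y ^ b\<close> with \<open>a + b = l\<close>,
  where \<open>x\<close> and \<open>y\<close> are the fanout times the path and value selectivity.  Complementarity
  allows every query to be averaged with its complement, which replaces the monomial by the
  symmetric sum \<open>x ^ a * y ^ b + x ^ b * y ^ a\<close>.  For fixed \<open>a + b\<close> this is smallest when the
  exponents are as balanced as possible, which the alternating vector achieves on all levels
  simultaneously.\<close>

text \<open>With \<open>m = a + c\<close> and \<open>n = a + d\<close>, right side minus left side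
  factors as \<open>x ^ a * y ^ a * ((x ^ c - y ^ c) * (x ^ d - y ^ d))\<close>. Both differences
  have the sign of \<open>x - y\<close> or vanish, since powers are monotone on non-negative
  numbers.\<close>

lemma symmetric_power_sum_mono:
  fixes x y :: "'a::linordered_idom"
  assumes "0 \<le> x" "0 \<le> y" "a \<le> m" "a \<le> n" "a + b = m + n"
  shows "x ^ m * y ^ n + x ^ n * y ^ m \<le> x ^ a * y ^ b + x ^ b * y ^ a"
proof -
  obtain c d where m: "m = a + c" and n: "n = a + d"
    using assms le_Suc_ex by metis
  have b: "b = a + c + d"
    using assms m n by simp
  have "0 \<le> (x ^ c - y ^ c) * (x ^ d - y ^ d)"
    using assms by (cases x y rule: le_cases) (simp_all add: zero_le_mult_iff power_mono)
  then have "0 \<le> (x ^ a * y ^ a) * ((x ^ c - y ^ c) * (x ^ d - y ^ d))"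
    using assms by simp
  also have "\<dots> = (x ^ a * y ^ b + x ^ b * y ^ a) - (x ^ m * y ^ n + x ^ n * y ^ m)"
    by (simp add: m n b power_add algebra_simps)
  finally show ?thesis
    by simp
qed

lemma symmetric_power_sum_balanced:
  fixes x y :: "'a::linordered_idom"
  assumes "0 \<le> x" "0 \<le> y" "a + b = l"
  shows "x ^ (l div 2) * y ^ (l - l div 2) + x ^ (l - l div 2) * y ^ (l div 2)
    \<le> x ^ a * y ^ b + x ^ b * y ^ a"
proof (cases "a \<le> b")
  case True
  with assms show ?thesis
    by (intro symmetric_power_sum_mono) auto
next
  case False
  with assms have "x ^ (l div 2) * y ^ (l - l div 2) + x ^ (l - l div 2) * y ^ (l div 2)
    \<le> x ^ b * y ^ a + x ^ a * y ^ b"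
    by (intro symmetric_power_sum_mono) auto
  then show ?thesis
    by (simp add: add.commute)
qed

text \<open>The exponents count the \<open>Path\<close> and \<open>Value\<close> entries on the
  first \<open>l\<close> levels. They are fixed before \<open>sP\<close> and \<open>sV\<close>, so
  one pair serves a query and its complement.\<close>

lemma prod_selectivity_monomial:
  obtains a b where "a + b = l"
    and "\<And>sP sV. (\<Prod>i = 1..l. c * selectivity (sP, sV) (\<phi> ! (i - 1))) = (c * sP) ^ a * (c * sV) ^ b"
proof -
  have "\<exists>a b. a + b = l \<and> (\<forall>sP sV.
    (\<Prod>i = 1..l. c * selectivity (sP, sV) (\<phi> ! (i - 1))) = (c * sP) ^ a * (c * sV) ^ b)"
  proof (induction l)
    case 0
    then show ?case by simp
  next
    case (Suc l)
    then obtain a b where ab: "a + b = l"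
      "\<And>sP sV. (\<Prod>i = 1..l. c * selectivity (sP, sV) (\<phi> ! (i - 1))) = (c * sP) ^ a * (c * sV) ^ b"
      by blast
    show ?case
    proof (cases "\<phi> ! l")
      case Path
      with ab show ?thesis
        by (intro exI[of _ "Suc a"] exI[of _ b]) (simp add: mult_ac)
    next
      case Value
      with ab show ?thesis
        by (intro exI[of _ a] exI[of _ "Suc b"]) (simp add: mult_ac)
    qed
  qed
  with that show ?thesis by blast
qed

lemma prod_selectivity_dynamic:
  assumes "l \<le> h"
  shows "(\<Prod>i = 1..l. c * selectivity (sP, sV) (dynamic_interleaving h ! (i - 1)))
    = (c * sP) ^ (l div 2) * (c * sV) ^ (l - l div 2)"
  using assms
proof (induction l)
  case 0
  then show ?case by simp
next
  case (Suc l)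
  \<comment> \<open>Index \<open>l\<close> holds level \<open>l + 1\<close>, hence the flipped
    parity.\<close>
  have "dynamic_interleaving h ! l = (if even l then Value else Path)"
    using Suc.prems by (simp add: dynamic_interleaving_def nth_append del: upt_Suc)
  moreover have "Suc l - l div 2 = Suc (l - l div 2)"
    by simp
  ultimately show ?case
    using Suc by (cases "even l") (simp_all add: mult_ac)
qed

lemma search_cost_nonneg:
  assumes "sP \<ge> 0" "sV \<ge> 0"
  shows "search_cost k h \<phi> (sP, sV) \<ge> 0"
proof -
  have "selectivity (sP, sV) d \<ge> 0" for d
    using assms by (cases d) auto
  then show ?thesis
    unfolding search_cost_def by (intro add_nonneg_nonneg sum_nonneg prod_nonneg) auto
qed

lemma search_cost_dynamic_symmetrized_le:
  assumes "sP \<ge> 0" "sV \<ge> 0"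
  shows "search_cost k h (dynamic_interleaving h) (sP, sV)
      + search_cost k h (dynamic_interleaving h) (sV, sP)
    \<le> search_cost k h \<phi> (sP, sV) + search_cost k h \<phi> (sV, sP)"
proof -
  let ?p = "\<lambda>\<phi> l q. \<Prod>i = 1..l. real k * selectivity q (\<phi> ! (i - 1))"
  have "?p (dynamic_interleaving h) l (sP, sV) + ?p (dynamic_interleaving h) l (sV, sP)
    \<le> ?p \<phi> l (sP, sV) + ?p \<phi> l (sV, sP)" if "l \<in> {1..h}" for l
  proof -
    from that have "l \<le> h"
      by simp
    obtain a b where "a + b = l"
      and "\<And>sP sV. ?p \<phi> l (sP, sV) = (real k * sP) ^ a * (real k * sV) ^ b"
      using prod_selectivity_monomial[of l "real k" \<phi>] by blast
    then show ?thesis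
      using symmetric_power_sum_balanced[of "real k * sP" "real k * sV" a b l] assms
      \<comment> \<open>The complement's monomials start with the power of
        \<open>real k * sV\<close>; commuting them matches the balanced inequality.\<close>
      unfolding prod_selectivity_dynamic[OF \<open>l \<le> h\<close>] by (simp only: mult.commute[of "(real k * sV) ^ _"]) simp
  qed
  then have "(\<Sum>l = 1..h. ?p (dynamic_interleaving h) l (sP, sV) + ?p (dynamic_interleaving h) l (sV, sP))
    \<le> (\<Sum>l = 1..h. ?p \<phi> l (sP, sV) + ?p \<phi> l (sV, sP))"
    by (rule sum_mono)
  then show ?thesis
    by (simp add: search_cost_def sum.distrib)
qed

text \<open>Swapping coordinates permutes \<open>Q\<close>, so summing over complements gives the
  same total. Doubling avoids choosing one query per pair and treating the diagonal
  separately.\<close>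

lemma double_total_cost:
  assumes "complementary_queries Q"
  shows "2 * total_cost k h \<phi> Q
    = (\<Sum>\<^sub>\<infinity>(sP, sV)\<in>Q. ennreal (search_cost k h \<phi> (sP, sV) + search_cost k h \<phi> (sV, sP)))"
proof -
  let ?f = "\<lambda>q. ennreal (search_cost k h \<phi> q)"
  have "bij_betw prod.swap Q Q"
    using assms by (intro bij_betwI[where g = prod.swap]) (auto simp: complementary_queries_def)
  then have "infsum (\<lambda>q. ?f (prod.swap q)) Q = infsum ?f Q"
    by (rule infsum_reindex_bij_betw)
  then have "2 * infsum ?f Q = infsum ?f Q + infsum (\<lambda>q. ?f (prod.swap q)) Q"
    by (simp add: mult_2)
  also have "\<dots> = (\<Sum>\<^sub>\<infinity>q\<in>Q. ?f q + ?f (prod.swap q))"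
    by (intro infsum_add[symmetric] nonneg_summable_on_complete) auto
  also have "\<dots> = (\<Sum>\<^sub>\<infinity>(sP, sV)\<in>Q. ennreal (search_cost k h \<phi> (sP, sV) + search_cost k h \<phi> (sV, sP)))"
    \<comment> \<open>Non-negative costs let \<open>ennreal\<close> commute with addition.\<close>
    using assms
    by (intro infsum_cong) (auto simp: complementary_queries_def search_cost_nonneg)
  finally show ?thesis
    by (simp add: total_cost_def)
qed

theorem theorem2:
  fixes fanout h :: nat and \<phi> :: "dimension list" and Q :: "query set"
  assumes "fanout \<ge> 1" and "h \<ge> 1"
    and "complementary_queries Q"
    and "admissible h \<phi>"
  shows "total_cost fanout h (dynamic_interleaving h) Q \<le> total_cost fanout h \<phi> Q"
proof -
  have "2 * total_cost fanout h (dynamic_interleaving h) Q \<le> 2 * total_cost fanout h \<phi> Q"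
    unfolding double_total_cost[OF assms(3)] using assms(3)
    by (intro infsum_mono nonneg_summable_on_complete)
      (auto simp: complementary_queries_def intro!: ennreal_leI search_cost_dynamic_symmetrized_le)
  \<comment> \<open>The factor 2 is finite and nonzero, so it cancels even when the totals are
    infinite.\<close>
  then show ?thesis
    by (simp add: ennreal_mult_le_mult_iff)
qed

end
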